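(* Let $\Lambda$ be a subset of $\mathbb{Z}^d$. The set $\Lambda$ is an infinite approximate subgroup if and only if there exists a linear subspace $L \subset \mathbb{R}^d$ such that $\Lambda$ is relatively dense around $L$.
   Context: $\mathbb{R}^d$ carries the Euclidean metric, and $B_r(x)$ denotes the closed ball of radius $r$ around $x$ in $\mathbb{R}^d$. A set $\Lambda\subset\mathbb{Z}^d$ is an approximate subgroup if there is a finite set $F\subset\mathbb{Z}^d$ with $\Lambda-\Lambda\subset\Lambda+F$, where $A\pm B=\{a\pm b: a\in A, b\in B\}$. A set $\Lambda\subset\mathbb{R}^d$ is relatively dense around a linear subspace $L\subset\mathbb{R}^d$ if there exists $R>0$ such that (i) $B_R(h)\cap\Lambda\neq\emptyset$ for every $h\in L$, and (ii) $\Lambda\subset\bigcup_{h\in L}B_R(h)$.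
   Formalization: The linear subspace L is required to be nonzero; with L = {0} allowed the claim fails, since the finite set Λ = {0} is relatively dense around {0} but is not infinite. *)

theory Defs
  imports "HOL-Analysis.Analysis" "HOL-Library.Set_Algebras"
begin

text \<open>\<open>\<int>\<^sup>d\<close>, as a subset of \<open>\<real>\<^sup>d\<close>, so that the Euclidean metric applies to its subsets directly.\<close>

definition integer_lattice :: "(real ^ 'n) set" where
  "integer_lattice = {x. \<forall>i. x $ i \<in> \<int>}"

text \<open>Infix minus on sets is relative complement, so \<open>A - B\<close> in the sense of Minkowski
  needs its own name; the Minkowski sum is \<open>+\<close> of theory \<open>Set_Algebras\<close>.\<close>

definition difference_set :: "'a::ab_group_add set \<Rightarrow> 'a set \<Rightarrow> 'a set" where
  "difference_set A B = {a - b | a b. a \<in> A \<and> b \<in> B}"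

definition approximate_subgroup :: "(real ^ 'n) set \<Rightarrow> bool" where
  "approximate_subgroup \<Lambda> \<longleftrightarrow>
     \<Lambda> \<subseteq> integer_lattice \<and>
     (\<exists>F. finite F \<and> F \<subseteq> integer_lattice \<and> difference_set \<Lambda> \<Lambda> \<subseteq> \<Lambda> + F)"

definition relatively_dense_around :: "(real ^ 'n) set \<Rightarrow> (real ^ 'n) set \<Rightarrow> bool" where
  "relatively_dense_around \<Lambda> L \<longleftrightarrow>
     (\<exists>R>0. (\<forall>h\<in>L. cball h R \<inter> \<Lambda> \<noteq> {}) \<and> \<Lambda> \<subseteq> (\<Union>h\<in>L. cball h R))"

end

theory Submission
  imports Defs
begin

text \<open>
  The lattice enters only through the finiteness of its bounded parts: for a subset \<open>A\<close> of
  \<open>\<int>\<^sup>d\<close>, being an approximate subgroup means that the differences of two elements of \<open>A\<close> are at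
  uniformly bounded distance from \<open>A\<close>, and being infinite means being unbounded. With this
  dictionary, a set relatively dense around \<open>L\<close> inherits approximate closure under differences
  from \<open>L\<close>, and it is unbounded exactly if \<open>L\<close> is, that is, if \<open>L \<noteq> {0}\<close>.

  The other direction is a coarse statement about an arbitrary nonempty set \<open>A\<close> in a Euclidean
  space (\<open>coarse_subgroup_near_subspace\<close>, essentially Schreiber's theorem), and it has two ideas.
  The first is to straighten the elements of \<open>A\<close>: starting from \<open>a \<in> A\<close>, double again and
  again, each time moving back into \<open>A\<close> by a bounded amount. Dividing the \<open>n\<close>-th term by \<open>2\<^sup>n\<close>
  gives a Cauchy sequence, whose limit \<open>v\<close> is close to \<open>a\<close> and has all its multiples \<open>2\<^sup>n v\<close> close
  to \<open>A\<close> (\<open>doubling_limit\<close>). Let \<open>V\<close> be the set of all vectors with this last property, and \<open>L\<close>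
  its span; then \<open>A\<close> is close to \<open>L\<close>.

  The second idea shows that \<open>L\<close> is close to \<open>A\<close>. Integer combinations of elements of \<open>V\<close> cannot
  be approximated one summand at a time, since the errors add up. Instead, for \<open>x \<in> L\<close>, take a
  point \<open>a \<in> A\<close> almost closest to \<open>x\<close>, and a finite set \<open>B \<subseteq> V\<close> spanning \<open>L\<close>. If \<open>a\<close> were
  far from \<open>x\<close>, then for a fixed large \<open>n\<close> one of the steps \<open>\<plusminus> 2\<^sup>n b\<close> with \<open>b \<in> B\<close> would
  approach \<open>x\<close> by more than any prescribed constant (\<open>span_step_decreases_norm\<close>). Rounding
  \<open>a \<plusminus> 2\<^sup>n b\<close> to \<open>A\<close> costs only a constant, so \<open>A\<close> would contain a point too close to \<open>x\<close>.
\<close>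

section \<open>Doubling inside a coarsely closed set\<close>

text \<open>The rounding error made at step \<open>n\<close> is divided by \<open>2\<^sup>n\<^sup>+\<^sup>1\<close>, so the errors sum to at most
  \<open>D\<close>; the same sum started at step \<open>n\<close> is at most \<open>D / 2\<^sup>n\<close>, which is what survives the
  multiplication by \<open>2\<^sup>n\<close>.\<close>

lemma doubling_limit:
  fixes A :: "'a::banach set"
  assumes double: "\<And>a. a \<in> A \<Longrightarrow> \<exists>c\<in>A. norm (2 *\<^sub>R a - c) \<le> D" and "a \<in> A"
  obtains v where "norm (v - a) \<le> D" "\<And>n. \<exists>c\<in>A. norm (2 ^ n *\<^sub>R v - c) \<le> D"
proof -
  have "\<exists>x. \<forall>n. (x n \<in> A \<and> (n = 0 \<longrightarrow> x n = a)) \<and> norm (2 *\<^sub>R x n - x (Suc n)) \<le> D"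
    using double \<open>a \<in> A\<close> by (intro dependent_nat_choice) auto
  then obtain x where x: "\<And>n. x n \<in> A" "x 0 = a"
    and step: "\<And>n. norm (2 *\<^sub>R x n - x (Suc n)) \<le> D"
    by metis
  have D: "0 \<le> D"
    using step[of 0] norm_ge_zero order_trans by blast
  define y where "y n = (1 / 2 ^ n) *\<^sub>R x n" for n
  (* Subtracting the tail of the geometric series makes the bound inductive in k. *)
  have near: "norm (y (n + k) - y n) \<le> D / 2 ^ n - D / 2 ^ (n + k)" for n k
  proof (induction k)
    case 0
    then show ?case by simp
  next
    case (Suc k)
    have "y (n + Suc k) - y (n + k)
        = - (1 / 2 ^ Suc (n + k)) *\<^sub>R (2 *\<^sub>R x (n + k) - x (Suc (n + k)))"
      by (simp add: y_def algebra_simps)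
    then have "norm (y (n + Suc k) - y (n + k))
        = norm (2 *\<^sub>R x (n + k) - x (Suc (n + k))) / 2 ^ Suc (n + k)"
      by simp
    also have "\<dots> \<le> D / 2 ^ Suc (n + k)"
      by (intro divide_right_mono step) simp
    finally have "norm (y (n + Suc k) - y (n + k)) \<le> D / 2 ^ Suc (n + k)" .
    moreover have "norm (y (n + Suc k) - y n)
        \<le> norm (y (n + Suc k) - y (n + k)) + norm (y (n + k) - y n)"
      using norm_triangle_ineq[of "y (n + Suc k) - y (n + k)" "y (n + k) - y n"] by simp
    moreover have "D / 2 ^ (n + k) = 2 * (D / 2 ^ Suc (n + k))"
      by simp
    ultimately show ?case
      using Suc.IH by simp
  qed
  have near': "norm (y m - y n) \<le> D / 2 ^ n" if "n \<le> m" for m n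
  proof -
    have "norm (y m - y n) \<le> D / 2 ^ n - D / 2 ^ m"
      using near[of n "m - n"] that by simp
    also have "\<dots> \<le> D / 2 ^ n"
      using D by simp
    finally show ?thesis .
  qed
  have "Cauchy y"
  proof (rule metric_CauchyI)
    fix e :: real
    assume "0 < e"
    have "(\<lambda>n. D * (1 / 2) ^ n) \<longlonglongrightarrow> D * 0"
      by (intro tendsto_intros LIMSEQ_realpow_zero) auto
    then have "eventually (\<lambda>n. D * (1 / 2) ^ n < e / 2) sequentially"
      using \<open>0 < e\<close> by (intro order_tendstoD) auto
    then obtain N where N: "D / 2 ^ N < e / 2"
      by (auto simp: eventually_sequentially power_one_over)
    show "\<exists>M. \<forall>m\<ge>M. \<forall>n\<ge>M. dist (y m) (y n) < e"
    proof (intro exI[of _ N] allI impI)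
      fix m n
      assume "N \<le> m" "N \<le> n"
      then have "dist (y m) (y N) < e / 2" "dist (y n) (y N) < e / 2"
        using near'[of N m] near'[of N n] le_less_trans[OF _ N] by (simp_all only: dist_norm)
      then show "dist (y m) (y n) < e"
        by (rule dist_triangle_half_l)
    qed
  qed
  then obtain v where v: "y \<longlonglongrightarrow> v"
    by (auto simp: Cauchy_convergent_iff convergent_def)
  have lim: "norm (v - y n) \<le> D / 2 ^ n" for n
  proof (rule Lim_bounded)
    show "(\<lambda>m. norm (y m - y n)) \<longlonglongrightarrow> norm (v - y n)"
      by (intro tendsto_intros v)
    show "\<forall>m\<ge>n. norm (y m - y n) \<le> D / 2 ^ n"
      using near' by blast
  qed
  show thesis
  proof
    show "norm (v - a) \<le> D"
      using lim[of 0] x by (simp add: y_def)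
    show "\<exists>c\<in>A. norm (2 ^ n *\<^sub>R v - c) \<le> D" for n
    proof
      have "2 ^ n *\<^sub>R v - x n = 2 ^ n *\<^sub>R (v - y n)"
        by (simp add: y_def algebra_simps)
      then have "norm (2 ^ n *\<^sub>R v - x n) = 2 ^ n * norm (v - y n)"
        by simp
      also have "\<dots> \<le> D"
        using lim[of n] by (simp add: field_simps)
      finally show "norm (2 ^ n *\<^sub>R v - x n) \<le> D" .
    qed (rule x)
  qed
qed

section \<open>Approaching a point of a subspace with finitely many steps\<close>

text \<open>The frame operator \<open>u \<mapsto> \<Sum>b\<in>B. (u \<bullet> b) b\<close> is injective on the span of \<open>B\<close>, because its
  quadratic form is \<open>\<Sum>b\<in>B. (u \<bullet> b)\<^sup>2\<close>; in finite dimension it is then bounded below, so the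
  coefficients \<open>u \<bullet> b\<close> cannot all be small compared with \<open>u\<close>.\<close>

lemma span_inner_lower_bound:
  fixes B :: "'a::euclidean_space set"
  assumes "finite B"
  obtains c where "c > 0" "\<And>u. u \<in> span B \<Longrightarrow> u \<noteq> 0 \<Longrightarrow> \<exists>b\<in>B. c * norm u \<le> \<bar>u \<bullet> b\<bar>"
proof -
  define f where "f u = (\<Sum>b\<in>B. (u \<bullet> b) *\<^sub>R b)" for u
  have "bounded_linear f"
    unfolding f_def by (intro bounded_linear_sum bounded_linear_intros)
  moreover have "u = 0" if u: "u \<in> span B" and "f u = 0" for u
  proof -
    have "(\<Sum>b\<in>B. (u \<bullet> b)\<^sup>2) = u \<bullet> f u"
      by (simp add: f_def inner_sum_right power2_eq_square)
    also have "\<dots> = 0"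
      using \<open>f u = 0\<close> by simp
    finally have "\<forall>b\<in>B. orthogonal u b"
      using assms by (simp add: sum_nonneg_eq_0_iff orthogonal_def)
    then have "orthogonal u u"
      using orthogonal_to_span[OF u] by blast
    then show "u = 0"
      by (simp add: orthogonal_self)
  qed
  ultimately obtain e where e: "e > 0" "\<And>u. u \<in> span B \<Longrightarrow> e * norm u \<le> norm (f u)"
    using injective_imp_isometric[of "span B" f] by (auto simp: mult.commute)
  define S where "S = (\<Sum>b\<in>B. norm b)"
  have S: "S \<ge> 0"
    unfolding S_def by (intro sum_nonneg) simp
  show thesis
  proof
    show "e / (1 + S) > 0"
      using e S by simp
    fix u
    assume u: "u \<in> span B" "u \<noteq> 0"
    show "\<exists>b\<in>B. e / (1 + S) * norm u \<le> \<bar>u \<bullet> b\<bar>"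
    proof (rule ccontr)
      assume "\<not> ?thesis"
      then have small: "\<bar>u \<bullet> b\<bar> \<le> e / (1 + S) * norm u" if "b \<in> B" for b
        using that by force
      have "e * norm u \<le> norm (f u)"
        by (intro e u)
      also have "\<dots> \<le> (\<Sum>b\<in>B. \<bar>u \<bullet> b\<bar> * norm b)"
        unfolding f_def by (rule sum_norm_le) simp
      also have "\<dots> \<le> (\<Sum>b\<in>B. e / (1 + S) * norm u * norm b)"
        by (intro sum_mono mult_right_mono small) auto
      also have "\<dots> = e * norm u * (S / (1 + S))"
        by (simp add: S_def sum_distrib_left sum_divide_distrib)
      also have "\<dots> < e * norm u * 1"
        using e S u by (intro mult_strict_left_mono) auto
      finally show False
        by simp
    qed
  qed
qed

text \<open>Expanding \<open>\<parallel>u - s\<parallel>\<^sup>2\<close> for \<open>s = \<plusminus> 2\<^sup>n b\<close>, the cross term is of order \<open>2\<^sup>n \<parallel>u\<parallel>\<close> for the best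
  choice of \<open>b\<close> and of the sign, while \<open>\<parallel>s\<parallel>\<^sup>2\<close> does not depend on \<open>u\<close>. Hence the gain in norm
  tends, as \<open>u\<close> grows, to at least a constant multiple of \<open>2\<^sup>n\<close>, and \<open>n\<close> can be fixed beforehand.\<close>

lemma span_step_decreases_norm:
  fixes B :: "'a::euclidean_space set"
  assumes "finite B" "K \<ge> 0"
  obtains n :: nat and R where
    "\<And>u. u \<in> span B \<Longrightarrow> norm u > R \<Longrightarrow>
      \<exists>b\<in>B. norm (u - 2 ^ n *\<^sub>R b) \<le> norm u - K \<or> norm (u + 2 ^ n *\<^sub>R b) \<le> norm u - K"
proof -
  obtain c where c: "c > 0"
    and inner_bound: "\<And>u. u \<in> span B \<Longrightarrow> u \<noteq> 0 \<Longrightarrow> \<exists>b\<in>B. c * norm u \<le> \<bar>u \<bullet> b\<bar>"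
    using span_inner_lower_bound[OF \<open>finite B\<close>] by metis
  obtain n where "K / c < 2 ^ n"
    using real_arch_pow[of 2 "K / c"] by auto
  then have gap: "2 ^ n * c - K > 0"
    using c by (simp add: field_simps)
  define M where "M = (\<Sum>b\<in>B. (norm (2 ^ n *\<^sub>R b))\<^sup>2)"
  have M: "M \<ge> 0"
    unfolding M_def by (intro sum_nonneg) simp
  define R where "R = K + M / (2 ^ n * c - K)"
  show thesis
  proof
    fix u
    assume u: "u \<in> span B" "norm u > R"
    have "R \<ge> K"
      using M gap by (simp add: R_def)
    then have "norm u > K" "u \<noteq> 0"
      using u assms(2) by auto
    have M_le: "M + K * norm u \<le> 2 ^ n * (c * norm u)"
    proof -
      have "M / (2 ^ n * c - K) \<le> norm u"
        using u(2) assms(2) by (simp add: R_def)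
      then show ?thesis
        using gap by (simp add: pos_divide_le_eq algebra_simps)
    qed
    obtain b where b: "b \<in> B" "c * norm u \<le> \<bar>u \<bullet> b\<bar>"
      using inner_bound u \<open>u \<noteq> 0\<close> by blast
    have decrease: "norm (u - s) \<le> norm u - K"
      if s: "2 ^ n * \<bar>u \<bullet> b\<bar> = u \<bullet> s" "norm s = norm (2 ^ n *\<^sub>R b)" for s
    proof (rule power2_le_imp_le)
      have "(norm s)\<^sup>2 \<le> M"
        unfolding M_def s(2)
        using member_le_sum[of b B "\<lambda>b. (norm (2 ^ n *\<^sub>R b))\<^sup>2"] b(1) \<open>finite B\<close> by simp
      moreover have "2 ^ n * (c * norm u) \<le> u \<bullet> s"
        unfolding s(1)[symmetric] using b(2) by simp
      moreover have "(norm (u - s))\<^sup>2 = (norm u)\<^sup>2 - 2 * (u \<bullet> s) + (norm s)\<^sup>2"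
        by (simp add: power2_norm_eq_inner inner_diff_left inner_diff_right inner_commute)
      moreover have "(norm u - K)\<^sup>2 = (norm u)\<^sup>2 - 2 * (K * norm u) + K\<^sup>2"
        by (simp add: power2_eq_square algebra_simps)
      ultimately show "(norm (u - s))\<^sup>2 \<le> (norm u - K)\<^sup>2"
        using M_le M zero_le_power2[of K] by linarith
    qed (use \<open>norm u > K\<close> in simp)
    show "\<exists>b\<in>B. norm (u - 2 ^ n *\<^sub>R b) \<le> norm u - K \<or> norm (u + 2 ^ n *\<^sub>R b) \<le> norm u - K"
    proof (cases "u \<bullet> b \<ge> 0")
      case True
      then show ?thesis
        using decrease[of "2 ^ n *\<^sub>R b"] b(1) by auto
    next
      case False
      then show ?thesis
        using decrease[of "- (2 ^ n *\<^sub>R b)"] b(1) by auto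
    qed
  qed
qed

section \<open>Coarse subgroups of a Euclidean space\<close>

text \<open>The points \<open>h\<close> of \<open>L\<close> are reached by minimality instead of by approximating a representation
  of \<open>h\<close> in a basis: whatever error was made in reaching a point of \<open>A\<close>, the next step starts
  from a point that is exactly in \<open>A\<close> and can correct it, so errors do not accumulate.\<close>

theorem coarse_subgroup_near_subspace:
  fixes A :: "'a::euclidean_space set"
  assumes "A \<noteq> {}"
    and diff: "\<And>a b. a \<in> A \<Longrightarrow> b \<in> A \<Longrightarrow> \<exists>c\<in>A. norm (a - b - c) \<le> C"
  obtains L R where "subspace L" "R > 0"
    "\<And>h. h \<in> L \<Longrightarrow> \<exists>a\<in>A. dist h a \<le> R" "\<And>a. a \<in> A \<Longrightarrow> \<exists>h\<in>L. dist h a \<le> R"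
proof -
  (* The difference of an element with itself puts a point z of A near 0; then differences
     z - a give approximate negatives, and these give approximate sums. *)
  obtain z where z: "z \<in> A" "norm z \<le> C"
    using diff \<open>A \<noteq> {}\<close> by fastforce
  have C: "C \<ge> 0"
    using z(2) norm_ge_zero order_trans by blast
  have minus: "\<exists>c\<in>A. norm (a + c) \<le> 2 * C" if a: "a \<in> A" for a
  proof -
    obtain c where c: "c \<in> A" "norm (z - a - c) \<le> C"
      using diff[OF z(1) a] by blast
    have "norm (z - (z - a - c)) \<le> norm z + norm (z - a - c)"
      by (rule norm_triangle_ineq4)
    moreover have "z - (z - a - c) = a + c"
      by simp
    ultimately show ?thesis
      using c z by (intro bexI[of _ c]) simp_all
  qed
  have plus: "\<exists>c\<in>A. norm (a + b - c) \<le> 3 * C" if a: "a \<in> A" and b: "b \<in> A" for a b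
  proof -
    obtain b' where b': "b' \<in> A" "norm (b + b') \<le> 2 * C"
      using minus[OF b] by blast
    obtain c where c: "c \<in> A" "norm (a - b' - c) \<le> C"
      using diff[OF a b'(1)] by blast
    have "norm ((a - b' - c) + (b + b')) \<le> norm (a - b' - c) + norm (b + b')"
      by (rule norm_triangle_ineq)
    moreover have "(a - b' - c) + (b + b') = a + b - c"
      by simp
    ultimately show ?thesis
      using c b' by (intro bexI[of _ c]) simp_all
  qed
  define D where "D = 3 * C"
  have D: "D \<ge> 0"
    using C by (simp add: D_def)
  define V where "V = {v. \<forall>n. \<exists>c\<in>A. norm (2 ^ n *\<^sub>R v - c) \<le> D}"
  have near_V: "\<exists>v\<in>V. norm (v - a) \<le> D" if a: "a \<in> A" for a
  proof -
    have "\<exists>c\<in>A. norm (2 *\<^sub>R x - c) \<le> D" if "x \<in> A" for x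
      using plus[OF that that] by (simp add: D_def scaleR_2)
    then obtain v where "norm (v - a) \<le> D" "\<And>n. \<exists>c\<in>A. norm (2 ^ n *\<^sub>R v - c) \<le> D"
      using doubling_limit[of A D a] a by blast
    then show ?thesis
      unfolding V_def by blast
  qed
  obtain B where B: "B \<subseteq> V" "independent B" "V \<subseteq> span B"
    by (rule maximal_independent_subset)
  have "finite B"
    using B(2) independent_imp_finite by blast
  (* The total cost of one step: 2 * D for passing from A to the span of B and back,
     3 * D for rounding the step into A, and 1 more to beat an almost closest point. *)
  obtain n R where step: "\<And>u. u \<in> span B \<Longrightarrow> norm u > R \<Longrightarrow>
      \<exists>b\<in>B. norm (u - 2 ^ n *\<^sub>R b) \<le> norm u - (5 * D + 1) \<or>
        norm (u + 2 ^ n *\<^sub>R b) \<le> norm u - (5 * D + 1)"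
    using span_step_decreases_norm[OF \<open>finite B\<close>, of "5 * D + 1"] D by (metis add_nonneg_nonneg mult_nonneg_nonneg zero_le_numeral zero_le_one)
  have translate: "\<exists>c\<in>A. norm (a + s - c) \<le> 3 * D"
    if a: "a \<in> A" and b: "b \<in> B" and s: "s = 2 ^ n *\<^sub>R b \<or> s = - (2 ^ n *\<^sub>R b)" for a b s
  proof -
    obtain d where d: "d \<in> A" "norm (2 ^ n *\<^sub>R b - d) \<le> D"
      using b B(1) by (auto simp: V_def)
    have "\<exists>d'\<in>A. norm (s - d') \<le> 2 * D"
      using s
    proof
      assume "s = 2 ^ n *\<^sub>R b"
      then show ?thesis
        using d D by (intro bexI[of _ d]) auto
    next
      assume s: "s = - (2 ^ n *\<^sub>R b)"
      obtain d' where d': "d' \<in> A" "norm (d + d') \<le> 2 * C"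
        using minus[OF d(1)] by blast
      have "norm (s - d') = norm ((2 ^ n *\<^sub>R b - d) + (d + d'))"
        unfolding s by (simp add: norm_minus_commute[of _ d'] add.commute)
      also have "\<dots> \<le> norm (2 ^ n *\<^sub>R b - d) + norm (d + d')"
        by (rule norm_triangle_ineq)
      finally show ?thesis
        using d d' C by (intro bexI[of _ d']) (auto simp: D_def)
    qed
    then obtain d' where d': "d' \<in> A" "norm (s - d') \<le> 2 * D"
      by blast
    obtain c where c: "c \<in> A" "norm (a + d' - c) \<le> D"
      using plus[OF a d'(1)] by (auto simp: D_def)
    have "norm ((a + d' - c) + (s - d')) \<le> norm (a + d' - c) + norm (s - d')"
      by (rule norm_triangle_ineq)
    moreover have "(a + d' - c) + (s - d') = a + s - c"
      by simp
    ultimately show ?thesis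
      using c d' by (intro bexI[of _ c]) simp_all
  qed
  have near_A: "\<exists>a\<in>A. dist x a \<le> R + D" if x: "x \<in> span B" for x
  proof -
    obtain a where a: "a \<in> A" "dist x a < infdist x A + 1"
      using cInf_lessD[of "dist x ` A" "infdist x A + 1"] \<open>A \<noteq> {}\<close>
      by (auto simp: infdist_notempty)
    obtain v where v: "v \<in> V" "norm (v - a) \<le> D"
      using near_V[OF a(1)] by blast
    define u where "u = x - v"
    have u: "u \<in> span B"
      using x v B(3) unfolding u_def by (intro span_diff) auto
    have "norm u \<le> R"
    proof (rule ccontr)
      assume "\<not> norm u \<le> R"
      then obtain b where "b \<in> B" and "norm (u - 2 ^ n *\<^sub>R b) \<le> norm u - (5 * D + 1) \<or>
          norm (u + 2 ^ n *\<^sub>R b) \<le> norm u - (5 * D + 1)"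
        using step[OF u] by auto
      then obtain s where s: "s = 2 ^ n *\<^sub>R b \<or> s = - (2 ^ n *\<^sub>R b)"
        "norm (u - s) \<le> norm u - (5 * D + 1)"
        by (metis diff_minus_eq_add)
      obtain c where c: "c \<in> A" "norm (a + s - c) \<le> 3 * D"
        using translate[OF a(1) \<open>b \<in> B\<close> s(1)] by blast
      have "x - c = (u - s) + ((v - a) + (a + s - c))"
        by (simp add: u_def)
      then have "norm (x - c) \<le> norm (u - s) + (norm (v - a) + norm (a + s - c))"
        by (simp only:) (intro norm_triangle_mono order_refl norm_triangle_ineq)
      moreover have "norm u \<le> norm (x - a) + norm (v - a)"
        using norm_triangle_ineq4[of "x - a" "v - a"] by (simp add: u_def)
      ultimately have "dist x c \<le> dist x a - 1"
        using s(2) c(2) v(2) by (simp add: dist_norm)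
      then show False
        using infdist_le[OF c(1), of x] a(2) by simp
    qed
    moreover have "norm (x - a) \<le> norm u + norm (v - a)"
      using norm_triangle_ineq[of u "v - a"] by (simp add: u_def)
    ultimately show ?thesis
      using a(1) v(2) by (intro bexI[of _ a]) (auto simp: dist_norm)
  qed
  show thesis
  proof
    show "subspace (span B)"
      by simp
    show "\<bar>R\<bar> + D + 1 > 0"
      using D by simp
    show "\<exists>a\<in>A. dist h a \<le> \<bar>R\<bar> + D + 1" if "h \<in> span B" for h
      using near_A[OF that] by force
    show "\<exists>h\<in>span B. dist h a \<le> \<bar>R\<bar> + D + 1" if a: "a \<in> A" for a
    proof -
      obtain v where "v \<in> V" "norm (v - a) \<le> D"
        using near_V[OF a] by blast
      then show ?thesis
        using B(3) D by (intro bexI[of _ v]) (auto simp: dist_norm)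
    qed
  qed
qed

section \<open>Subsets of the integer lattice\<close>

lemma finite_integer_lattice_bounded:
  assumes "bounded S" "S \<subseteq> integer_lattice"
  shows "finite (S :: (real ^ 'n) set)"
proof -
  obtain r where r: "\<And>x. x \<in> S \<Longrightarrow> norm x \<le> r"
    using assms(1) by (auto simp: bounded_iff)
  let ?I = "{k \<in> \<int>. \<bar>k\<bar> \<le> r}"
  have "x \<in> vec_lambda ` (UNIV \<rightarrow>\<^sub>E ?I)" if "x \<in> S" for x
  proof
    show "x = vec_lambda (vec_nth x)"
      by simp
    show "vec_nth x \<in> UNIV \<rightarrow>\<^sub>E ?I"
      using that assms(2) r[OF that] component_le_norm_cart[of x]
      by (auto simp: integer_lattice_def intro: order_trans)
  qed
  moreover have "finite (vec_lambda ` ((UNIV :: 'n set) \<rightarrow>\<^sub>E ?I))"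
    by (intro finite_imageI finite_PiE finite_abs_int_segment) simp
  ultimately show ?thesis
    by (meson finite_subset subsetI)
qed

lemma integer_lattice_diff:
  "a \<in> integer_lattice \<Longrightarrow> b \<in> integer_lattice \<Longrightarrow> a - b \<in> integer_lattice"
  by (simp add: integer_lattice_def)

text \<open>The errors \<open>a - b - c\<close> are themselves lattice vectors, so a uniform bound on them leaves
  only finitely many, and these can serve as the finite set \<open>F\<close>.\<close>

lemma approximate_subgroup_iff_coarse:
  assumes "\<Lambda> \<subseteq> integer_lattice"
  shows "approximate_subgroup \<Lambda> \<longleftrightarrow>
    (\<exists>C. \<forall>a\<in>\<Lambda>. \<forall>b\<in>\<Lambda>. \<exists>c\<in>\<Lambda>. norm (a - b - c) \<le> C)" (is "_ \<longleftrightarrow> ?coarse")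
proof
  assume "approximate_subgroup \<Lambda>"
  then obtain F where F: "finite F" "difference_set \<Lambda> \<Lambda> \<subseteq> \<Lambda> + F"
    by (auto simp: approximate_subgroup_def)
  obtain C where C: "\<And>f. f \<in> F \<Longrightarrow> norm f \<le> C"
    using finite_imp_bounded[OF F(1)] by (auto simp: bounded_iff)
  have "\<exists>c\<in>\<Lambda>. norm (a - b - c) \<le> C" if "a \<in> \<Lambda>" "b \<in> \<Lambda>" for a b
  proof -
    have "a - b \<in> \<Lambda> + F"
      using F(2) that by (auto simp: difference_set_def)
    then obtain c f where "c \<in> \<Lambda>" "f \<in> F" "a - b = c + f"
      by (auto elim: set_plus_elim)
    then show ?thesis
      using C by (intro bexI[of _ c]) auto
  qed
  then show ?coarse
    by blast
next
  assume ?coarse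
  then obtain C where C: "\<And>a b. a \<in> \<Lambda> \<Longrightarrow> b \<in> \<Lambda> \<Longrightarrow> \<exists>c\<in>\<Lambda>. norm (a - b - c) \<le> C"
    by blast
  let ?F = "cball 0 C \<inter> integer_lattice"
  have "finite ?F"
    by (intro finite_integer_lattice_bounded bounded_Int) auto
  moreover have "difference_set \<Lambda> \<Lambda> \<subseteq> \<Lambda> + ?F"
  proof
    fix x
    assume "x \<in> difference_set \<Lambda> \<Lambda>"
    then obtain a b where ab: "a \<in> \<Lambda>" "b \<in> \<Lambda>" "x = a - b"
      by (auto simp: difference_set_def)
    then obtain c where c: "c \<in> \<Lambda>" "norm (a - b - c) \<le> C"
      using C by blast
    have "a - b - c \<in> ?F"
      using ab c assms by (auto intro!: integer_lattice_diff)
    then have "c + (a - b - c) \<in> \<Lambda> + ?F"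
      using c(1) by (intro set_plus_intro)
    then show "x \<in> \<Lambda> + ?F"
      using ab(3) by simp
  qed
  ultimately show "approximate_subgroup \<Lambda>"
    unfolding approximate_subgroup_def using assms by blast
qed

lemma relatively_dense_around_imp_coarse:
  assumes "subspace L" "relatively_dense_around \<Lambda> L"
  shows "\<exists>C. \<forall>a\<in>\<Lambda>. \<forall>b\<in>\<Lambda>. \<exists>c\<in>\<Lambda>. norm (a - b - c) \<le> C"
proof -
  obtain R where R: "\<And>h. h \<in> L \<Longrightarrow> \<exists>a\<in>\<Lambda>. norm (h - a) \<le> R"
    "\<And>a. a \<in> \<Lambda> \<Longrightarrow> \<exists>h\<in>L. norm (h - a) \<le> R"
    using assms(2) unfolding relatively_dense_around_def
    by (fastforce simp: dist_norm)
  have "\<exists>c\<in>\<Lambda>. norm (a - b - c) \<le> 3 * R" if ab: "a \<in> \<Lambda>" "b \<in> \<Lambda>" for a b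
  proof -
    obtain g h where gh: "g \<in> L" "norm (g - a) \<le> R" "h \<in> L" "norm (h - b) \<le> R"
      using R(2) ab by meson
    obtain c where c: "c \<in> \<Lambda>" "norm (g - h - c) \<le> R"
      using R(1)[OF subspace_diff[OF assms(1) gh(1,3)]] by blast
    have "a - b - c = (g - h - c) + ((h - b) - (g - a))"
      by simp
    then have "norm (a - b - c) \<le> norm (g - h - c) + (norm (h - b) + norm (g - a))"
      by (simp only:) (intro norm_triangle_mono order_refl norm_triangle_ineq4)
    then show ?thesis
      using c gh by (intro bexI[of _ c]) auto
  qed
  then show ?thesis
    by blast
qed

lemma relatively_dense_around_bounded_iff:
  assumes "subspace L" "relatively_dense_around \<Lambda> L"
  shows "bounded \<Lambda> \<longleftrightarrow> L = {0}"
proof -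
  obtain R where R: "\<And>h. h \<in> L \<Longrightarrow> \<exists>a\<in>\<Lambda>. dist h a \<le> R"
    "\<And>a. a \<in> \<Lambda> \<Longrightarrow> \<exists>h\<in>L. dist h a \<le> R"
    using assms(2) unfolding relatively_dense_around_def by fastforce
  show ?thesis
  proof
    assume "bounded \<Lambda>"
    then obtain r where r: "\<And>a. a \<in> \<Lambda> \<Longrightarrow> norm a \<le> r"
      by (auto simp: bounded_iff)
    have le: "norm h \<le> r + R" if h: "h \<in> L" for h
    proof -
      obtain a where a: "a \<in> \<Lambda>" "norm (h - a) \<le> R"
        using R(1)[OF h] by (auto simp: dist_norm)
      then show ?thesis
        using norm_triangle_ineq2[of h a] r[OF a(1)] by linarith
    qed
    have "h = 0" if "h \<in> L" for h
    proof (rule ccontr)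
      assume "h \<noteq> 0"
      obtain n :: nat where "r + R < real n * norm h"
        using reals_Archimedean3[of "norm h"] \<open>h \<noteq> 0\<close> by auto
      moreover have "real n *\<^sub>R h \<in> L"
        using assms(1) that by (rule subspace_scale)
      ultimately show False
        using le[of "real n *\<^sub>R h"] by simp
    qed
    then show "L = {0}"
      using subspace_0[OF assms(1)] by blast
  next
    assume "L = {0}"
    then show "bounded \<Lambda>"
      using R(2) by (auto simp: bounded_iff)
  qed
qed

theorem theorem2p4:
  fixes \<Lambda> :: "(real ^ 'n) set"
  assumes "\<Lambda> \<subseteq> integer_lattice"
  shows "infinite \<Lambda> \<and> approximate_subgroup \<Lambda> \<longleftrightarrow>
    (\<exists>L. subspace L \<and> L \<noteq> {0} \<and> relatively_dense_around \<Lambda> L)"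
proof
  assume \<Lambda>: "infinite \<Lambda> \<and> approximate_subgroup \<Lambda>"
  then have "\<Lambda> \<noteq> {}"
    by auto
  moreover obtain C where "\<And>a b. a \<in> \<Lambda> \<Longrightarrow> b \<in> \<Lambda> \<Longrightarrow> \<exists>c\<in>\<Lambda>. norm (a - b - c) \<le> C"
    using \<Lambda> approximate_subgroup_iff_coarse[OF assms] by blast
  ultimately obtain L R where L: "subspace L" "R > 0"
    "\<And>h. h \<in> L \<Longrightarrow> \<exists>a\<in>\<Lambda>. dist h a \<le> R" "\<And>a. a \<in> \<Lambda> \<Longrightarrow> \<exists>h\<in>L. dist h a \<le> R"
    using coarse_subgroup_near_subspace[of \<Lambda> C] by metis
  have dense: "relatively_dense_around \<Lambda> L"
    unfolding relatively_dense_around_def using L(2-4) by (intro exI[of _ R]) fastforce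
  have "\<not> bounded \<Lambda>"
    using \<Lambda> finite_integer_lattice_bounded assms by blast
  then show "\<exists>L. subspace L \<and> L \<noteq> {0} \<and> relatively_dense_around \<Lambda> L"
    using relatively_dense_around_bounded_iff[OF L(1) dense] L(1) dense by blast
next
  assume "\<exists>L. subspace L \<and> L \<noteq> {0} \<and> relatively_dense_around \<Lambda> L"
  then obtain L where L: "subspace L" "L \<noteq> {0}" "relatively_dense_around \<Lambda> L"
    by blast
  then have "infinite \<Lambda>"
    using relatively_dense_around_bounded_iff finite_imp_bounded by blast
  then show "infinite \<Lambda> \<and> approximate_subgroup \<Lambda>"
    using approximate_subgroup_iff_coarse[OF assms]
      relatively_dense_around_imp_coarse[OF L(1,3)] by blast
qed

end
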